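(* Let $X\in\mathbb{R}^d$ be a random vector of the form $$X=\mu+\zeta,$$ where $\zeta$ is a zero-mean Gaussian vector in $\mathbb{R}^d$, independent of the random vector $\mu\in\mathbb{R}^d$, which has probability distribution $F_\mu$ ($\mu$ may be discrete or not, and the existence of a density is not assumed). Assume that all the first-order moments $m_k=\mathbb{E}\mu_k$ of $\mu$ exist. Then if $A=\{\alpha_1,\dots,\alpha_{2N+\epsilon}\}$, with $\epsilon\in\{0,1\}$, is a set of integers (repetitions allowed) with $1\le\alpha_i\le d$ for all $i$, $$\mathbb{E}X_A=\sum_{k=0}^{N}\ \sum_{\substack{S\subset A\\ |S|=2k+\epsilon}}\mathbb{E}(\mu_S)\ \underset{A\backslash S}{\sum\prod}\,\mathbb{E}(\zeta_i\zeta_j).$$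
   Context: Multi-index notation: a "set" $A=\{\alpha_1,\dots,\alpha_n\}$ of integers with $1\le\alpha_i\le d$ is a finite indexed family in which the $\alpha_i$ need not be distinct. Subsets $S\subset A$, complements $A\backslash S$, cardinalities and pairings are taken with respect to the positions $1,\dots,n$ (so repeated values count as different elements; a subset $S$ corresponds to a subset $I\subset\{1,\dots,n\}$, and $|S|=|I|$). For a vector $v\in\mathbb{R}^d$ (deterministic or random), $v_A=\prod_{i=1}^n v_{\alpha_i}$, with the convention $v_\emptyset=1$; similarly $v_S=\prod_{i\in I}v_{\alpha_i}$. Thus $\mathbb{E}(\mu_S)$ is the expectation of the product of the components of $\mu$ indexed by $S$. A pairing of $A$ is a partition of (the positions of) $A$ into disjoint pairs; $\Pi(A)$ is the set of all pairings of $A$. It is empty if $|A|$ is odd, and for $A=\emptyset$ it consists of the single empty pairing. For a random vector $Y\in\mathbb{R}^d$, $$\underset{A}{\sum\prod}\,\mathbb{E}(Y_iY_j):=\sum_{\sigma\in\Pi(A)}\ \prod_{\{a,b\}\in\sigma}\mathbb{E}(Y_{\alpha_a}Y_{\alpha_b}),$$ i.e. the sum over all pairings of the product, over pairs of the pairing, of the second moments of the paired components (equal to $1$ when $A=\emptyset$). For example, $\underset{\{1,1,2,4\}}{\sum\prod}\mathbb{E}(Y_iY_j)=\mathbb{E}(Y_1^2)\mathbb{E}(Y_2Y_4)+2\,\mathbb{E}(Y_1Y_2)\mathbb{E}(Y_1Y_4)$.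
   Formalization: Existence of first-order moments alone does not make the formula meaningful; it is proved assuming that the moments E(μ_S) on the right-hand side and E(X_A) exist (are finite), and E(X_A) is shown to exist if all E(μ_S), S⊂A, do. *)

theory Defs
  imports "HOL-Probability.Probability" "HOL-Library.Disjoint_Sets"
begin

(* The law N(m, s^2), where s is the standard deviation; s = 0 is the point mass at m. *)
definition normal_law :: "real \<Rightarrow> real \<Rightarrow> real measure" where
  "normal_law m s =
     (if s = 0 then return borel m
      else density lborel (\<lambda>x. ennreal (normal_density m s x)))"

(* Every linear combination of the components is normal; since s = 0 is allowed,
   the covariance matrix may be singular. *)
definition gaussian_vector :: "'a measure \<Rightarrow> ('a \<Rightarrow> real ^ 'd) \<Rightarrow> bool" where
  "gaussian_vector M Z \<longleftrightarrow>
     Z \<in> borel_measurable M \<and>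
     (\<forall>a. \<exists>m s. s \<ge> 0 \<and> distr M borel (\<lambda>\<omega>. a \<bullet> Z \<omega>) = normal_law m s)"

(* An indexed family alpha_1, ..., alpha_n of coordinates, with repetitions allowed, is a
   function alpha on positions; a subfamily is given by its set I of positions.
   This is the product v_S, and it equals 1 for empty I. *)
definition idx_prod :: "(nat \<Rightarrow> 'd) \<Rightarrow> nat set \<Rightarrow> real ^ 'd \<Rightarrow> real" where
  "idx_prod \<alpha> I v = (\<Prod>i\<in>I. v $ \<alpha> i)"

definition pairings :: "'b set \<Rightarrow> 'b set set set" where
  "pairings I = {\<sigma>. partition_on I \<sigma> \<and> (\<forall>B\<in>\<sigma>. card B = 2)}"

(* A block B of a pairing is a set {a, b} of two positions, so the inner integral is the
   second moment of the components alpha_a and alpha_b of Y. *)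
definition pairing_sum ::
    "'a measure \<Rightarrow> ('a \<Rightarrow> real ^ 'd) \<Rightarrow> (nat \<Rightarrow> 'd) \<Rightarrow> nat set \<Rightarrow> real" where
  "pairing_sum M Y \<alpha> I =
     (\<Sum>\<sigma>\<in>pairings I. \<Prod>B\<in>\<sigma>. (\<integral>\<omega>. idx_prod \<alpha> B (Y \<omega>) \<partial>M))"

end

theory Submission
  imports Defs
begin

text \<open>
  The product of the components of \<open>\<mu> + \<zeta>\<close> over the positions \<open>A\<close> expands into the sum, over the
  subsets \<open>S\<close> of \<open>A\<close>, of the monomial of \<open>\<mu>\<close> over \<open>S\<close> times the monomial of \<open>\<zeta>\<close> over the
  complement (\<open>idx_prod_add\<close>). Where the complement has even size, both factors are integrable and
  independent, so the expectation of the term factorizes, and the Gaussian factor is a pairing sum by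
  Isserlis' theorem (\<open>isserlis\<close>). The terms with a complement of odd size must contribute nothing.
  The moments of \<open>\<mu>\<close> in them need not exist; yet their sum is integrable as soon as the full product
  is, so Fubini's theorem (\<open>indep_integral_eq_0_of_sections\<close>) applies to the sum, and for each fixed
  value of \<open>\<mu>\<close> the integral over \<open>\<zeta>\<close> is a combination of odd Gaussian moments, hence \<open>0\<close>.

  Isserlis' theorem is obtained from the moments of one-dimensional normal laws alone. The mixed
  moment and the pairing sum are both symmetric and multilinear in the variables at the positions. When
  all these variables equal one linear form of \<open>\<zeta>\<close> with variance \<open>v\<close>, and there are \<open>2 k\<close> of them,
  the mixed moment is \<open>fact (2 * k) / (2 ^ k * fact k) * v ^ k\<close> and the pairing sum is \<open>v ^ k\<close> times
  the number of pairings; these agree by \<open>card_pairings\<close>. Polarization (\<open>polarization_zero\<close>) then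
  carries the equality from the diagonal to arbitrary variables.
\<close>

section \<open>Summation over maps on a finite set of positions\<close>

text \<open>Choosing a map on \<open>\<Union>P\<close> is the same as choosing a map on every block independently, so a
  product of factors, each of which looks at one block only, can be summed block by block.\<close>
lemma sum_prod_over_blocks:
  fixes C :: "'b set \<Rightarrow> ('b \<Rightarrow> 'c) \<Rightarrow> 'r :: comm_semiring_1"
  assumes "finite P" "disjoint P" "\<And>B. B \<in> P \<Longrightarrow> finite B" "finite T"
    and loc: "\<And>B f g. B \<in> P \<Longrightarrow> (\<And>i. i \<in> B \<Longrightarrow> f i = g i) \<Longrightarrow> C B f = C B g"
  shows "(\<Sum>f\<in>\<Union>P \<rightarrow>\<^sub>E T. \<Prod>B\<in>P. C B f) = (\<Prod>B\<in>P. \<Sum>g\<in>B \<rightarrow>\<^sub>E T. C B g)"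
proof -
  define blk where "blk i = (THE B. B \<in> P \<and> i \<in> B)" for i
  have blk: "blk i = B" if "B \<in> P" "i \<in> B" for i B
    unfolding blk_def using that \<open>disjoint P\<close>
    by (intro the_equality) (auto simp: disjoint_def)
  \<comment> \<open>The product of sums is a sum over families \<open>h\<close> of maps on the blocks, and such a family is
    glued to one map on \<open>\<Union>P\<close>.\<close>
  have "(\<Prod>B\<in>P. \<Sum>g\<in>B \<rightarrow>\<^sub>E T. C B g)
      = (\<Sum>h\<in>Pi\<^sub>E P (\<lambda>B. B \<rightarrow>\<^sub>E T). \<Prod>B\<in>P. C B (h B))"
    using assms by (intro prod_sum_PiE finite_PiE) auto
  also have "\<dots> = (\<Sum>f\<in>\<Union>P \<rightarrow>\<^sub>E T. \<Prod>B\<in>P. C B f)"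
  proof (rule sum.reindex_bij_witness
      [of _ "\<lambda>f. \<lambda>B\<in>P. restrict f B" "\<lambda>h. \<lambda>i\<in>\<Union>P. h (blk i) i"])
    fix h assume h: "h \<in> Pi\<^sub>E P (\<lambda>B. B \<rightarrow>\<^sub>E T)"
    have hB: "h B \<in> B \<rightarrow>\<^sub>E T" if "B \<in> P" for B
      using h that by auto
    show "(\<lambda>B\<in>P. restrict (\<lambda>i\<in>\<Union>P. h (blk i) i) B) = h"
    proof
      fix B
      show "(\<lambda>B\<in>P. restrict (\<lambda>i\<in>\<Union>P. h (blk i) i) B) B = h B"
      proof (cases "B \<in> P")
        case True
        show ?thesis
        proof
          fix i
          show "(\<lambda>B\<in>P. restrict (\<lambda>i\<in>\<Union>P. h (blk i) i) B) B i = h B i"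
            using True hB[OF True] blk[OF True, of i] by (cases "i \<in> B") auto
        qed
      next
        case False
        then show ?thesis using h by (auto simp: PiE_def extensional_def)
      qed
    qed
    have val: "(\<lambda>i\<in>\<Union>P. h (blk i) i) i = h B i" if "B \<in> P" "i \<in> B" for B i
      using that blk[OF that] by auto
    show "(\<lambda>i\<in>\<Union>P. h (blk i) i) \<in> \<Union>P \<rightarrow>\<^sub>E T"
    proof (rule PiE_I)
      fix i assume "i \<in> \<Union>P"
      then obtain B where B: "B \<in> P" "i \<in> B" by blast
      show "(\<lambda>i\<in>\<Union>P. h (blk i) i) i \<in> T"
        unfolding val[OF B] using PiE_mem[OF hB[OF B(1)] B(2)] .
    qed simp
    show "(\<Prod>B\<in>P. C B (\<lambda>i\<in>\<Union>P. h (blk i) i)) = (\<Prod>B\<in>P. C B (h B))"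
      by (intro prod.cong refl) (rule loc, assumption, rule val)
  next
    fix f assume f: "f \<in> \<Union>P \<rightarrow>\<^sub>E T"
    show "(\<lambda>i\<in>\<Union>P. (\<lambda>B\<in>P. restrict f B) (blk i) i) = f"
    proof
      fix i
      show "(\<lambda>i\<in>\<Union>P. (\<lambda>B\<in>P. restrict f B) (blk i) i) i = f i"
      proof (cases "i \<in> \<Union>P")
        case True
        then obtain B where B: "B \<in> P" "i \<in> B" by blast
        then show ?thesis using True blk[OF B] by simp
      next
        case False
        then show ?thesis using PiE_arb[OF f False] by simp
      qed
    qed
    show "(\<lambda>B\<in>P. restrict f B) \<in> Pi\<^sub>E P (\<lambda>B. B \<rightarrow>\<^sub>E T)"
      using f by auto
  qed
  finally show ?thesis ..
qed

text \<open>Polarization without signs. Think of \<open>D f\<close> as a multilinear form evaluated at the vectors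
  \<open>v (f i)\<close>; the sum over all \<open>f\<close> from \<open>I\<close> to \<open>T\<close> is then its value with every argument equal to
  \<open>\<Sum>t\<in>T. v t\<close>. If all these diagonal values vanish, then induction on \<open>T\<close> shows that the sum over
  the maps onto \<open>T\<close> vanishes too, since a map into \<open>T\<close> is onto exactly one subset of \<open>T\<close>.
  For \<open>T = I\<close> the maps onto \<open>I\<close> are the permutations, on which a symmetric form is constant.\<close>
lemma polarization_zero:
  fixes D :: "('b \<Rightarrow> 'b) \<Rightarrow> real"
  assumes fin: "finite I"
    and diag: "\<And>T. T \<subseteq> I \<Longrightarrow> (\<Sum>f\<in>I \<rightarrow>\<^sub>E T. D f) = 0"
    and sym: "\<And>f. f \<in> I \<rightarrow>\<^sub>E I \<Longrightarrow> bij_betw f I I \<Longrightarrow> D f = d"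
  shows "d = 0"
proof -
  define S where "S T = {f \<in> I \<rightarrow>\<^sub>E T. f ` I = T}" for T :: "'b set"
  have finS: "finite (S T)" if "T \<subseteq> I" for T
  proof (rule finite_subset)
    show "finite (I \<rightarrow>\<^sub>E T)"
      using fin finite_subset[OF that fin] by (simp add: finite_PiE)
  qed (simp add: S_def)
  have onto: "T \<subseteq> I \<Longrightarrow> (\<Sum>f\<in>S T. D f) = 0" for T
  proof (induction "card T" arbitrary: T rule: less_induct)
    case less
    have "finite T" using less.prems fin by (rule finite_subset)
    have split: "I \<rightarrow>\<^sub>E T = (\<Union>T'\<in>Pow T. S T')"
      unfolding S_def by (auto simp: PiE_def)
    have "0 = (\<Sum>f\<in>I \<rightarrow>\<^sub>E T. D f)" using diag less.prems by simp
    also have "\<dots> = (\<Sum>T'\<in>Pow T. \<Sum>f\<in>S T'. D f)"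
      unfolding split using \<open>finite T\<close> less.prems finS
      by (intro sum.UNION_disjoint) (auto simp: S_def)
    also have "\<dots> = (\<Sum>T'\<in>{T}. \<Sum>f\<in>S T'. D f)"
    proof (rule sum.mono_neutral_right)
      show "\<forall>T'\<in>Pow T - {T}. (\<Sum>f\<in>S T'. D f) = 0"
        using less.hyps less.prems \<open>finite T\<close> by (auto intro!: psubset_card_mono)
    qed (use \<open>finite T\<close> in auto)
    finally show ?case by simp
  qed
  have "D f = d" if "f \<in> S I" for f
    using that fin unfolding S_def
    by (intro sym) (auto simp: bij_betw_def intro: eq_card_imp_inj_on)
  then have "real (card (S I)) * d = 0" using onto[of I] by simp
  moreover have "restrict id I \<in> S I" by (auto simp: S_def)
  then have "card (S I) \<noteq> 0" using finS[of I] by auto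
  ultimately show ?thesis by simp
qed

section \<open>Pairings\<close>

lemma finite_pairings: "finite I \<Longrightarrow> finite (pairings I)"
  unfolding pairings_def by (rule finite_subset[OF _ finitely_many_partition_on]) auto

lemma card_eq_of_pairing:
  assumes "finite I" "\<sigma> \<in> pairings I"
  shows "card I = 2 * card \<sigma>"
proof -
  have "card I = (\<Sum>B\<in>\<sigma>. card B)"
    using assms by (intro product_partition) (auto simp: pairings_def intro: card_ge_0_finite)
  also have "\<dots> = 2 * card \<sigma>" using assms by (simp add: pairings_def)
  finally show ?thesis .
qed

lemma pairings_odd: "finite I \<Longrightarrow> odd (card I) \<Longrightarrow> pairings I = {}"
  using card_eq_of_pairing by fastforce

text \<open>A pairing is determined by the partner \<open>j\<close> of a fixed position \<open>i\<close> and a pairing of the rest.\<close>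
lemma pairings_remove:
  assumes "i \<in> I"
  shows "pairings I = (\<Union>j\<in>I - {i}. insert {i, j} ` pairings (I - {i, j}))"
proof (intro set_eqI iffI)
  fix \<sigma> assume "\<sigma> \<in> pairings I"
  then have \<sigma>: "partition_on I \<sigma>" "\<forall>B\<in>\<sigma>. card B = 2" by (auto simp: pairings_def)
  then obtain B where B: "B \<in> \<sigma>" "i \<in> B" using assms by (auto simp: partition_on_def)
  from B \<sigma>(2) have "card B = 2" by blast
  with \<open>i \<in> B\<close> obtain j where j: "B = {i, j}" "j \<noteq> i"
    by (metis card_2_iff doubleton_eq_iff empty_iff insert_iff)
  have disj: "disjnt B (\<Union>(\<sigma> - {B}))"
    using partition_onD2[OF \<sigma>(1)] B by (auto simp: disjnt_def disjoint_def)
  have ins: "insert B (\<sigma> - {B}) = \<sigma>" using B by auto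
  have "partition_on (I - B) (\<sigma> - {B})" "B \<subseteq> I"
    using partition_on_insert[OF disj, of I] \<sigma>(1) unfolding ins by auto
  then show "\<sigma> \<in> (\<Union>j\<in>I - {i}. insert {i, j} ` pairings (I - {i, j}))"
    using j \<sigma>(2) ins by (auto simp: pairings_def intro!: bexI[of _ j] image_eqI[of _ _ "\<sigma> - {B}"])
next
  fix \<sigma> assume "\<sigma> \<in> (\<Union>j\<in>I - {i}. insert {i, j} ` pairings (I - {i, j}))"
  then obtain j \<tau> where j: "j \<in> I" "j \<noteq> i" "\<sigma> = insert {i, j} \<tau>"
    and \<tau>: "partition_on (I - {i, j}) \<tau>" "\<forall>B\<in>\<tau>. card B = 2"
    by (auto simp: pairings_def)
  have "disjnt {i, j} (\<Union>\<tau>)" using partition_onD1[OF \<tau>(1)] by (auto simp: disjnt_def)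
  from partition_on_insert[OF this, of I] show "\<sigma> \<in> pairings I"
    using assms j \<tau> by (auto simp: pairings_def)
qed

text \<open>The number of pairings is \<open>(2 k - 1)!!\<close>, the coefficient that also occurs in the even moments
  of a normal law. The product form avoids division in the natural numbers.\<close>
lemma card_pairings:
  fixes I :: "'b set"
  assumes "finite I" "card I = 2 * k"
  shows "card (pairings I) * (2 ^ k * fact k) = fact (2 * k)"
  using assms
proof (induction k arbitrary: I)
  case 0
  then have "pairings I = {{}}" by (auto simp: pairings_def partition_on_empty)
  then show ?case by simp
next
  case (Suc k)
  then obtain i where i: "i \<in> I" by fastforce
  \<comment> \<open>A pairing that misses \<open>i\<close> has no block containing \<open>i\<close>. So inserting such a block is
    injective, and different partners \<open>j\<close> give different pairings.\<close>
  have new: "{i, j} \<notin> \<sigma>" if "\<sigma> \<in> pairings (I - {i, j'})" for j j' :: 'b and \<sigma>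
    using that by (auto simp: pairings_def partition_on_def)
  have one: "card (insert {i, j} ` pairings (I - {i, j})) * (2 ^ k * fact k) = fact (2 * k)"
    if "j \<in> I - {i}" for j
  proof -
    have "inj_on (insert {i, j}) (pairings (I - {i, j}))"
      using new by (intro inj_onI) (metis insert_ident)
    moreover have "card (I - {i, j}) = 2 * k"
      using Suc.prems i that by (subst card_Diff_subset) (auto simp: card_insert_if)
    ultimately show ?thesis using Suc.IH Suc.prems(1) by (simp add: card_image)
  qed
  have "card (pairings I) = (\<Sum>j\<in>I - {i}. card (insert {i, j} ` pairings (I - {i, j})))"
    unfolding pairings_remove[OF i]
  proof (rule card_UN_disjoint)
    show "\<forall>j\<in>I - {i}. finite (insert {i, j} ` pairings (I - {i, j}))"
      using Suc.prems(1) by (auto intro: finite_pairings)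
    show "\<forall>j\<in>I - {i}. \<forall>j'\<in>I - {i}. j \<noteq> j' \<longrightarrow>
      insert {i, j} ` pairings (I - {i, j}) \<inter> insert {i, j'} ` pairings (I - {i, j'}) = {}"
    proof (intro ballI impI)
      fix j j' :: 'b assume "j \<noteq> j'"
      then have "{i, j} \<noteq> {i, j'}" by (auto simp: doubleton_eq_iff)
      then show "insert {i, j} ` pairings (I - {i, j}) \<inter>
          insert {i, j'} ` pairings (I - {i, j'}) = {}"
      proof (intro equals0I, elim IntE imageE)
        fix \<rho> \<sigma> \<tau>
        assume "\<rho> = insert {i, j} \<sigma>" "\<rho> = insert {i, j'} \<tau>"
          and \<tau>: "\<tau> \<in> pairings (I - {i, j'})"
        then have "{i, j} \<in> insert {i, j'} \<tau>" by (metis insertI1)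
        with \<open>{i, j} \<noteq> {i, j'}\<close> new[OF \<tau>] show False by auto
      qed
    qed
  qed (use Suc.prems in auto)
  then have "card (pairings I) * (2 ^ k * fact k) = (\<Sum>j\<in>I - {i}. fact (2 * k))"
    using one by (simp add: sum_distrib_right)
  also have "\<dots> = (2 * k + 1) * fact (2 * k)"
    using i Suc.prems by (simp add: card_Diff_singleton)
  finally have "card (pairings I) * (2 ^ k * fact k) = (2 * k + 1) * fact (2 * k)" .
  then have "(2 * (k + 1)) * (card (pairings I) * (2 ^ k * fact k))
     = (2 * (k + 1)) * ((2 * k + 1) * fact (2 * k))" by simp
  then show ?case by (simp add: algebra_simps)
qed

section \<open>Moments of normal laws\<close>

lemma has_bochner_integral_return_real:
  fixes f :: "real \<Rightarrow> real"
  assumes [measurable]: "f \<in> borel_measurable borel"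
  shows "has_bochner_integral (return borel x) f (f x)"
proof -
  interpret prob_space "return borel x" by (rule prob_space_return) simp
  have "integrable (return borel x) f \<longleftrightarrow> integrable (return borel x) (\<lambda>_. f x)"
    by (intro integrable_cong_AE) (auto simp: AE_return)
  then show ?thesis by (simp add: has_bochner_integral_iff integral_return)
qed

lemma
  assumes "s \<ge> 0"
  shows normal_law_moment_even:
      "has_bochner_integral (normal_law m s) (\<lambda>x. (x - m) ^ (2 * k))
         (fact (2 * k) / (2 ^ k * fact k) * (s\<^sup>2) ^ k)"
    and normal_law_moment_odd:
      "has_bochner_integral (normal_law m s) (\<lambda>x. (x - m) ^ (2 * k + 1)) 0"
proof -
  have *: "has_bochner_integral (normal_law m s) (\<lambda>x. (x - m) ^ (2 * k))
         (fact (2 * k) / (2 ^ k * fact k) * (s\<^sup>2) ^ k)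
     \<and> has_bochner_integral (normal_law m s) (\<lambda>x. (x - m) ^ (2 * k + 1)) 0"
  proof (cases "s = 0")
    case True
    show ?thesis
      using has_bochner_integral_return_real[of "\<lambda>x. (x - m) ^ (2 * k)" m]
        has_bochner_integral_return_real[of "\<lambda>x. (x - m) ^ (2 * k + 1)" m] True
      by (cases k) (auto simp: normal_law_def)
  next
    case False
    then have "s > 0" using assms by simp
    have "fact (2 * k) / ((2 / s\<^sup>2) ^ k * fact k) = fact (2 * k) / (2 ^ k * fact k) * (s\<^sup>2) ^ k"
      using False by (simp add: power_divide field_simps)
    then show ?thesis
      using False normal_moment_even[OF \<open>s > 0\<close>, of m k] normal_moment_odd[OF \<open>s > 0\<close>, of m k]
      unfolding normal_law_def by (auto intro!: has_bochner_integral_density)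
  qed
  then show "has_bochner_integral (normal_law m s) (\<lambda>x. (x - m) ^ (2 * k))
         (fact (2 * k) / (2 ^ k * fact k) * (s\<^sup>2) ^ k)"
    "has_bochner_integral (normal_law m s) (\<lambda>x. (x - m) ^ (2 * k + 1)) 0"
    by blast+
qed

lemma normal_law_mean:
  assumes "s \<ge> 0"
  shows "has_bochner_integral (normal_law m s) (\<lambda>x. x) m"
proof -
  have "has_bochner_integral (normal_law m s) (\<lambda>x. (x - m) + m * (x - m) ^ 0) (0 + m * 1)"
    using normal_law_moment_even[OF assms, of m 0] normal_law_moment_odd[OF assms, of m 0]
    by (intro has_bochner_integral_add has_bochner_integral_mult_right) auto
  then show ?thesis by simp
qed

text \<open>Every linear form of a centered Gaussian vector is a centered normal variable, so its even moments
  are multiples of powers of its variance and its odd moments vanish. The hypothesis on the mean is a statement about a vector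
  integral, which is \<open>0\<close> by default for a function that is not integrable. So integrability of \<open>Z\<close>
  is proved first, in order to conclude that each linear form has mean \<open>0\<close>.\<close>
lemma gaussian_vector_centered_moments:
  fixes Z :: "'a \<Rightarrow> real ^ 'd"
  assumes "gaussian_vector M Z" and mean: "(\<integral>\<omega>. Z \<omega> \<partial>M) = 0"
  shows "integrable M (\<lambda>\<omega>. (a \<bullet> Z \<omega>) ^ n)"
    and "odd n \<Longrightarrow> (\<integral>\<omega>. (a \<bullet> Z \<omega>) ^ n \<partial>M) = 0"
    and "(\<integral>\<omega>. (a \<bullet> Z \<omega>) ^ (2 * k) \<partial>M)
           = fact (2 * k) / (2 ^ k * fact k) * (\<integral>\<omega>. (a \<bullet> Z \<omega>)\<^sup>2 \<partial>M) ^ k"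
proof -
  have [measurable]: "Z \<in> borel_measurable M"
    and gauss: "\<exists>m s. s \<ge> 0 \<and> distr M borel (\<lambda>\<omega>. a \<bullet> Z \<omega>) = normal_law m s" for a
    using assms(1) by (auto simp: gaussian_vector_def)
  have transfer: "has_bochner_integral M (\<lambda>\<omega>. g (a \<bullet> Z \<omega>)) c
      \<longleftrightarrow> has_bochner_integral (distr M borel (\<lambda>\<omega>. a \<bullet> Z \<omega>)) g c"
    if "g \<in> borel_measurable borel" for g :: "real \<Rightarrow> real" and a c
    using that by (simp add: has_bochner_integral_iff integrable_distr_eq integral_distr)
  have int1: "integrable M (\<lambda>\<omega>. a \<bullet> Z \<omega>)" for a
  proof -
    obtain m s where "s \<ge> 0" "distr M borel (\<lambda>\<omega>. a \<bullet> Z \<omega>) = normal_law m s"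
      using gauss by blast
    then have "has_bochner_integral M (\<lambda>\<omega>. a \<bullet> Z \<omega>) m"
      by (intro transfer[THEN iffD2]) (simp_all add: normal_law_mean)
    then show ?thesis by (rule integrable.intros)
  qed
  have "integrable M (\<lambda>\<omega>. \<Sum>b\<in>Basis. (b \<bullet> Z \<omega>) *\<^sub>R b)"
    by (intro Bochner_Integration.integrable_sum integrable_scaleR_left int1)
  then have intZ: "integrable M Z"
    by (simp add: euclidean_representation inner_commute[of _ "Z _"])
  obtain m s where s: "s \<ge> 0" and law: "distr M borel (\<lambda>\<omega>. a \<bullet> Z \<omega>) = normal_law m s"
    using gauss by blast
  have "has_bochner_integral M (\<lambda>\<omega>. a \<bullet> Z \<omega>) m"
    by (rule transfer[THEN iffD2]) (simp_all add: law normal_law_mean s)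
  moreover have "(\<integral>\<omega>. a \<bullet> Z \<omega> \<partial>M) = 0"
    using intZ mean by simp
  ultimately have "m = 0" by (simp add: has_bochner_integral_iff)
  have ev: "has_bochner_integral M (\<lambda>\<omega>. (a \<bullet> Z \<omega>) ^ (2 * k))
        (fact (2 * k) / (2 ^ k * fact k) * (s\<^sup>2) ^ k)" for k
    using normal_law_moment_even[OF s, of m k]
    by (intro transfer[THEN iffD2]) (simp_all add: law \<open>m = 0\<close>)
  have od: "has_bochner_integral M (\<lambda>\<omega>. (a \<bullet> Z \<omega>) ^ (2 * k + 1)) 0" for k
    using normal_law_moment_odd[OF s, of m k]
    by (intro transfer[THEN iffD2]) (simp_all add: law \<open>m = 0\<close>)
  show "integrable M (\<lambda>\<omega>. (a \<bullet> Z \<omega>) ^ n)"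
    using ev[THEN integrable.intros] od[THEN integrable.intros]
    by (cases "even n") (auto elim!: evenE oddE)
  show "(\<integral>\<omega>. (a \<bullet> Z \<omega>) ^ n \<partial>M) = 0" if "odd n"
    using od that by (auto elim!: oddE simp: has_bochner_integral_iff)
  show "(\<integral>\<omega>. (a \<bullet> Z \<omega>) ^ (2 * k) \<partial>M)
           = fact (2 * k) / (2 ^ k * fact k) * (\<integral>\<omega>. (a \<bullet> Z \<omega>)\<^sup>2 \<partial>M) ^ k"
    using ev[of k] ev[of 1] by (simp add: has_bochner_integral_iff)
qed

text \<open>This reduces the integrability of a monomial in several variables to that of powers of single
  variables.\<close>
lemma prod_abs_le_sum_power:
  fixes x :: "'b \<Rightarrow> real"
  assumes "finite I" "I \<noteq> {}"
  shows "(\<Prod>i\<in>I. \<bar>x i\<bar>) \<le> (\<Sum>i\<in>I. \<bar>x i\<bar> ^ card I)"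
proof -
  have "Max ((\<lambda>i. \<bar>x i\<bar>) ` I) \<in> (\<lambda>i. \<bar>x i\<bar>) ` I"
    using assms by (intro Max_in) auto
  then obtain j where "j \<in> I" "Max ((\<lambda>i. \<bar>x i\<bar>) ` I) = \<bar>x j\<bar>" by auto
  with assms(1) have j: "j \<in> I" "\<And>i. i \<in> I \<Longrightarrow> \<bar>x i\<bar> \<le> \<bar>x j\<bar>"
    using Max_ge[of "(\<lambda>i. \<bar>x i\<bar>) ` I"] by force+
  have "(\<Prod>i\<in>I. \<bar>x i\<bar>) \<le> (\<Prod>i\<in>I. \<bar>x j\<bar>)"
    using j by (intro prod_mono) auto
  also have "\<dots> = \<bar>x j\<bar> ^ card I" by simp
  also have "\<dots> \<le> (\<Sum>i\<in>I. \<bar>x i\<bar> ^ card I)"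
    using assms j by (intro member_le_sum) auto
  finally show ?thesis .
qed

section \<open>Isserlis' theorem\<close>

lemma idx_prod_measurable [measurable]: "idx_prod \<alpha> I \<in> borel_measurable borel"
  unfolding idx_prod_def by (intro borel_measurable_prod) simp

context
  fixes M :: "'a measure" and Z :: "'a \<Rightarrow> real ^ 'd"
  assumes M: "prob_space M" and gauss: "gaussian_vector M Z" and mean: "(\<integral>\<omega>. Z \<omega> \<partial>M) = 0"
begin

lemma integrable_gaussian_monomial:
  assumes "finite I"
  shows "integrable M (\<lambda>\<omega>. idx_prod \<alpha> I (Z \<omega>))"
proof (cases "I = {}")
  case True
  interpret prob_space M by (rule M)
  show ?thesis using True by (simp add: idx_prod_def)
next
  case False
  have [measurable]: "Z \<in> borel_measurable M" using gauss by (auto simp: gaussian_vector_def)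
  have "integrable M (\<lambda>\<omega>. \<Sum>i\<in>I. \<bar>Z \<omega> $ \<alpha> i\<bar> ^ card I)"
  proof (rule Bochner_Integration.integrable_sum)
    fix i
    have "integrable M (\<lambda>\<omega>. \<bar>(axis (\<alpha> i) 1 \<bullet> Z \<omega>) ^ card I\<bar>)"
      using gaussian_vector_centered_moments(1)[OF gauss mean] by (rule integrable_abs)
    then show "integrable M (\<lambda>\<omega>. \<bar>Z \<omega> $ \<alpha> i\<bar> ^ card I)"
      by (simp add: inner_axis' power_abs)
  qed
  then show ?thesis
  proof (rule Bochner_Integration.integrable_bound)
    show "AE \<omega> in M. norm (idx_prod \<alpha> I (Z \<omega>)) \<le> norm (\<Sum>i\<in>I. \<bar>Z \<omega> $ \<alpha> i\<bar> ^ card I)"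
      using prod_abs_le_sum_power[OF assms False]
      by (auto simp: idx_prod_def abs_prod intro!: AE_I2 order_trans[OF _ abs_ge_self])
  qed measurable
qed

text \<open>Mixed moments are multilinear in the variables: summing them over all ways to distribute \<open>T\<close>
  over the positions expands the power of one linear form of \<open>Z\<close>.\<close>
lemma sum_gaussian_monomials:
  assumes "finite I" "finite T"
  shows "(\<Sum>f\<in>I \<rightarrow>\<^sub>E T. \<integral>\<omega>. idx_prod (\<alpha> \<circ> f) I (Z \<omega>) \<partial>M)
       = (\<integral>\<omega>. ((\<Sum>t\<in>T. axis (\<alpha> t) 1) \<bullet> Z \<omega>) ^ card I \<partial>M)"
proof -
  have "(\<Sum>f\<in>I \<rightarrow>\<^sub>E T. \<integral>\<omega>. idx_prod (\<alpha> \<circ> f) I (Z \<omega>) \<partial>M)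
      = (\<integral>\<omega>. (\<Sum>f\<in>I \<rightarrow>\<^sub>E T. idx_prod (\<alpha> \<circ> f) I (Z \<omega>)) \<partial>M)"
    using assms by (intro Bochner_Integration.integral_sum[symmetric] integrable_gaussian_monomial)
  also have "\<dots> = (\<integral>\<omega>. ((\<Sum>t\<in>T. axis (\<alpha> t) 1) \<bullet> Z \<omega>) ^ card I \<partial>M)"
  proof (intro Bochner_Integration.integral_cong refl)
    fix \<omega>
    have "(\<Sum>f\<in>I \<rightarrow>\<^sub>E T. idx_prod (\<alpha> \<circ> f) I (Z \<omega>)) = (\<Prod>i\<in>I. \<Sum>t\<in>T. Z \<omega> $ \<alpha> t)"
      using assms by (subst prod_sum_PiE) (auto simp: idx_prod_def)
    then show "(\<Sum>f\<in>I \<rightarrow>\<^sub>E T. idx_prod (\<alpha> \<circ> f) I (Z \<omega>))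
        = ((\<Sum>t\<in>T. axis (\<alpha> t) 1) \<bullet> Z \<omega>) ^ card I"
      by (simp add: inner_sum_left inner_axis')
  qed
  finally show ?thesis .
qed

text \<open>The pairing sum has the same diagonal values as the mixed moment. Each pairing of \<open>2 k\<close> positions
  contributes the \<open>k\<close>-th power of the variance of the linear form, and the number of pairings is the
  coefficient in its moment of order \<open>2 k\<close>. An odd number of positions has no pairing, in agreement
  with the vanishing of the odd moments.\<close>
lemma sum_pairing_sums:
  assumes "finite I" "finite T"
  shows "(\<Sum>f\<in>I \<rightarrow>\<^sub>E T. pairing_sum M Z (\<alpha> \<circ> f) I)
       = (\<integral>\<omega>. ((\<Sum>t\<in>T. axis (\<alpha> t) 1) \<bullet> Z \<omega>) ^ card I \<partial>M)"
proof -
  let ?a = "\<Sum>t\<in>T. axis (\<alpha> t) 1 :: real ^ 'd"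
  let ?v = "\<integral>\<omega>. (?a \<bullet> Z \<omega>)\<^sup>2 \<partial>M"
  let ?C = "\<lambda>B f. \<integral>\<omega>. idx_prod (\<alpha> \<circ> f) B (Z \<omega>) \<partial>M"
  have one: "(\<Sum>f\<in>I \<rightarrow>\<^sub>E T. \<Prod>B\<in>\<sigma>. ?C B f) = ?v ^ card \<sigma>" if \<sigma>: "\<sigma> \<in> pairings I" for \<sigma>
  proof -
    have I: "I = \<Union>\<sigma>" and "disjoint \<sigma>" and two: "\<And>B. B \<in> \<sigma> \<Longrightarrow> card B = 2"
      using \<sigma> by (auto simp: pairings_def partition_on_def)
    have fin: "finite B" if "B \<in> \<sigma>" for B
      using two[OF that] by (auto intro: card_ge_0_finite)
    have "(\<Sum>f\<in>I \<rightarrow>\<^sub>E T. \<Prod>B\<in>\<sigma>. ?C B f) = (\<Prod>B\<in>\<sigma>. \<Sum>g\<in>B \<rightarrow>\<^sub>E T. ?C B g)"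
      unfolding I
    proof (rule sum_prod_over_blocks)
      show "finite \<sigma>" using assms I by (metis finite_UnionD)
      show "?C B f = ?C B g" if "\<And>i. i \<in> B \<Longrightarrow> f i = g i" for B f g
        using that by (simp add: idx_prod_def cong: prod.cong)
    qed (use \<open>disjoint \<sigma>\<close> fin assms in auto)
    also have "\<dots> = (\<Prod>B\<in>\<sigma>. ?v)"
      using assms fin two by (intro prod.cong refl) (simp add: sum_gaussian_monomials)
    finally show ?thesis by simp
  qed
  have "(\<Sum>f\<in>I \<rightarrow>\<^sub>E T. pairing_sum M Z (\<alpha> \<circ> f) I)
      = (\<Sum>\<sigma>\<in>pairings I. \<Sum>f\<in>I \<rightarrow>\<^sub>E T. \<Prod>B\<in>\<sigma>. ?C B f)"
    unfolding pairing_sum_def by (rule sum.swap)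
  also have "\<dots> = (\<Sum>\<sigma>\<in>pairings I. ?v ^ card \<sigma>)"
    using one by simp
  also have "\<dots> = (\<integral>\<omega>. (?a \<bullet> Z \<omega>) ^ card I \<partial>M)"
  proof (cases "even (card I)")
    case True
    then obtain k where k: "card I = 2 * k" by blast
    have "real (card (pairings I)) * (2 ^ k * fact k) = fact (2 * k)"
      using card_pairings[OF assms(1) k] by (metis of_nat_fact of_nat_mult of_nat_numeral of_nat_power)
    then have "real (card (pairings I)) = fact (2 * k) / (2 ^ k * fact k)"
      by (simp add: field_simps)
    moreover have "card \<sigma> = k" if "\<sigma> \<in> pairings I" for \<sigma>
      using card_eq_of_pairing[OF assms(1) that] k by simp
    ultimately show ?thesis
      by (simp add: k gaussian_vector_centered_moments(3)[OF gauss mean])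
  next
    case False
    then have "pairings I = {}" using assms(1) by (simp add: pairings_odd)
    then show ?thesis
      using False gaussian_vector_centered_moments(2)[OF gauss mean] by simp
  qed
  finally show ?thesis .
qed

text \<open>A permutation of the positions permutes the pairings.\<close>
lemma pairing_sum_permute:
  assumes "finite I" "bij_betw f I I"
  shows "pairing_sum M Z (\<alpha> \<circ> f) I = pairing_sum M Z \<alpha> I"
proof -
  have f: "inj_on f I" "f ` I = I" using assms by (auto simp: bij_betw_def)
  have sub: "B \<subseteq> I" "B \<noteq> {}" if "\<sigma> \<in> pairings I" "B \<in> \<sigma>" for \<sigma> B
    using that by (auto simp: pairings_def partition_on_def)
  have img: "(`) f ` \<sigma> \<in> pairings I" if "\<sigma> \<in> pairings I" for \<sigma>
  proof -
    have "partition_on I \<sigma>" "\<And>B. B \<in> \<sigma> \<Longrightarrow> card B = 2"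
      using that by (auto simp: pairings_def)
    moreover have "(`) f ` \<sigma> - {{}} = (`) f ` \<sigma>"
      using sub(2)[OF that] by auto
    moreover have "card (f ` B) = card B" if "B \<in> \<sigma>" for B
      using f sub[OF \<open>\<sigma> \<in> pairings I\<close> that] by (intro card_image) (auto intro: inj_on_subset)
    ultimately show ?thesis
      using partition_on_inj_image[of I \<sigma> f] f by (auto simp: pairings_def)
  qed
  have "inj_on ((`) ((`) f)) (Pow (Pow I))"
    using f by (intro inj_on_image_Pow)
  then have inj: "inj_on ((`) ((`) f)) (pairings I)"
    by (rule inj_on_subset) (auto dest: sub(1))
  have "(`) ((`) f) ` pairings I \<subseteq> pairings I" using img by auto
  then have "(`) ((`) f) ` pairings I = pairings I"
    using inj assms by (intro endo_inj_surj finite_pairings)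
  then have "pairing_sum M Z \<alpha> I
      = (\<Sum>\<sigma>\<in>(`) ((`) f) ` pairings I. \<Prod>B\<in>\<sigma>. \<integral>\<omega>. idx_prod \<alpha> B (Z \<omega>) \<partial>M)"
    by (simp add: pairing_sum_def)
  also have "\<dots> = pairing_sum M Z (\<alpha> \<circ> f) I"
    unfolding pairing_sum_def sum.reindex[OF inj] o_def
  proof (intro sum.cong refl)
    fix \<sigma> assume \<sigma>: "\<sigma> \<in> pairings I"
    have "inj_on ((`) f) \<sigma>"
      using inj_on_image_Pow[OF f(1)] by (rule inj_on_subset) (use sub(1)[OF \<sigma>] in auto)
    moreover have "idx_prod \<alpha> (f ` B) z = idx_prod (\<lambda>x. \<alpha> (f x)) B z" if "B \<in> \<sigma>" for B and z :: "real ^ 'd"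
      using inj_on_subset[OF f(1) sub(1)[OF \<sigma> that]] by (simp add: idx_prod_def prod.reindex)
    ultimately show "(\<Prod>B\<in>(`) f ` \<sigma>. \<integral>\<omega>. idx_prod \<alpha> B (Z \<omega>) \<partial>M)
        = (\<Prod>B\<in>\<sigma>. \<integral>\<omega>. idx_prod (\<lambda>x. \<alpha> (f x)) B (Z \<omega>) \<partial>M)"
      by (simp add: prod.reindex)
  qed
  finally show ?thesis ..
qed

text \<open>Both sides are symmetric multilinear forms in the variables at the positions of \<open>I\<close>, and they
  agree on the diagonal; polarization makes them equal. In this way the joint law of the components
  never enters, only the laws of linear forms.\<close>
lemma isserlis:
  assumes "finite I"
  shows "(\<integral>\<omega>. idx_prod \<alpha> I (Z \<omega>) \<partial>M) = pairing_sum M Z \<alpha> I"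
proof -
  have "(\<integral>\<omega>. idx_prod \<alpha> I (Z \<omega>) \<partial>M) - pairing_sum M Z \<alpha> I = 0"
  proof (rule polarization_zero[OF assms, where
      D = "\<lambda>f. (\<integral>\<omega>. idx_prod (\<alpha> \<circ> f) I (Z \<omega>) \<partial>M) - pairing_sum M Z (\<alpha> \<circ> f) I"])
    fix T assume "T \<subseteq> I"
    then have "finite T" using assms by (rule finite_subset)
    then show "(\<Sum>f\<in>I \<rightarrow>\<^sub>E T. (\<integral>\<omega>. idx_prod (\<alpha> \<circ> f) I (Z \<omega>) \<partial>M)
        - pairing_sum M Z (\<alpha> \<circ> f) I) = 0"
      using assms by (simp add: sum_subtractf sum_gaussian_monomials sum_pairing_sums)
  next
    fix f assume f: "bij_betw f I I"
    have "idx_prod (\<alpha> \<circ> f) I z = idx_prod \<alpha> I z" for z :: "real ^ 'd"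
      unfolding idx_prod_def o_def using prod.reindex_bij_betw[OF f, of "\<lambda>i. z $ \<alpha> i"] .
    then show "(\<integral>\<omega>. idx_prod (\<alpha> \<circ> f) I (Z \<omega>) \<partial>M) - pairing_sum M Z (\<alpha> \<circ> f) I
        = (\<integral>\<omega>. idx_prod \<alpha> I (Z \<omega>) \<partial>M) - pairing_sum M Z \<alpha> I"
      using pairing_sum_permute[OF assms f] by simp
  qed
  then show ?thesis by simp
qed

end

section \<open>Moments of a sum with an independent Gaussian vector\<close>

lemma idx_prod_add:
  assumes "finite I"
  shows "idx_prod \<alpha> I (u + v) = (\<Sum>S\<in>Pow I. idx_prod \<alpha> S u * idx_prod \<alpha> (I - S) v)"
  using prod_add[OF assms, of "\<lambda>i. u $ \<alpha> i" "\<lambda>i. v $ \<alpha> i"] by (simp add: idx_prod_def)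

text \<open>Conditioning on \<open>U\<close> by Fubini's theorem. Integrability is asked of \<open>g (U, V)\<close> as a whole: when
  \<open>g\<close> is a sum of products, no single summand has to be integrable.\<close>
lemma (in prob_space) indep_integral_eq_0_of_sections:
  fixes g :: "'b \<times> 'b \<Rightarrow> real"
  assumes ind: "indep_var S U T V"
    and g: "g \<in> borel_measurable (S \<Otimes>\<^sub>M T)"
    and int: "integrable M (\<lambda>\<omega>. g (U \<omega>, V \<omega>))"
    and sec: "\<And>u. u \<in> space S \<Longrightarrow> (\<integral>\<omega>. g (u, V \<omega>) \<partial>M) = 0"
  shows "(\<integral>\<omega>. g (U \<omega>, V \<omega>) \<partial>M) = 0"
proof -
  have U: "random_variable S U" and V: "random_variable T V"
    and joint: "distr M S U \<Otimes>\<^sub>M distr M T V = distr M (S \<Otimes>\<^sub>M T) (\<lambda>\<omega>. (U \<omega>, V \<omega>))"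
    using ind by (auto simp: indep_var_distribution_eq)
  have UV: "(\<lambda>\<omega>. (U \<omega>, V \<omega>)) \<in> measurable M (S \<Otimes>\<^sub>M T)"
    using U V by simp
  interpret PU: prob_space "distr M S U" using U by (rule prob_space_distr)
  interpret PV: prob_space "distr M T V" using V by (rule prob_space_distr)
  interpret pair_sigma_finite "distr M S U" "distr M T V" ..
  have "integrable (distr M S U \<Otimes>\<^sub>M distr M T V) g"
    unfolding joint using int g UV by (simp add: integrable_distr_eq)
  then have "integral\<^sup>L (distr M S U \<Otimes>\<^sub>M distr M T V) g
      = (\<integral>u. (\<integral>v. g (u, v) \<partial>distr M T V) \<partial>distr M S U)"
    by (rule integral_fst'[symmetric])
  also have "\<dots> = (\<integral>u. 0 \<partial>distr M S U)"
  proof (intro Bochner_Integration.integral_cong refl)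
    fix u assume "u \<in> space (distr M S U)"
    then have u: "u \<in> space S" by simp
    then have "(\<lambda>v. g (u, v)) \<in> borel_measurable T"
      using g by (rule measurable_compose_Pair1)
    then show "(\<integral>v. g (u, v) \<partial>distr M T V) = 0"
      using V sec[OF u] by (simp add: integral_distr)
  qed
  finally have "integral\<^sup>L (distr M (S \<Otimes>\<^sub>M T) (\<lambda>\<omega>. (U \<omega>, V \<omega>))) g = 0"
    unfolding joint by simp
  then show ?thesis using g UV by (simp add: integral_distr)
qed

theorem theorem3:
  fixes M :: "'a measure"
    and X \<mu> \<zeta> :: "'a \<Rightarrow> real ^ 'd"
    and \<alpha> :: "nat \<Rightarrow> 'd"
    and N \<epsilon> :: nat
  assumes "prob_space M"
    and "\<mu> \<in> borel_measurable M"
    and "gaussian_vector M \<zeta>"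
    and "(\<integral>\<omega>. \<zeta> \<omega> \<partial>M) = 0"
    and "prob_space.indep_var M borel \<mu> borel \<zeta>"
    and "\<And>\<omega>. \<omega> \<in> space M \<Longrightarrow> X \<omega> = \<mu> \<omega> + \<zeta> \<omega>"
    and "\<And>k. integrable M (\<lambda>\<omega>. \<mu> \<omega> $ k)"
    and "\<epsilon> \<in> {0, 1}"
    and "\<And>k S. k \<le> N \<Longrightarrow> S \<subseteq> {1..2 * N + \<epsilon>} \<Longrightarrow> card S = 2 * k + \<epsilon> \<Longrightarrow>
           integrable M (\<lambda>\<omega>. idx_prod \<alpha> S (\<mu> \<omega>))"
  shows "(integrable M (\<lambda>\<omega>. idx_prod \<alpha> {1..2 * N + \<epsilon>} (X \<omega>)) \<longrightarrow>
           (\<integral>\<omega>. idx_prod \<alpha> {1..2 * N + \<epsilon>} (X \<omega>) \<partial>M) =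
             (\<Sum>k=0..N. \<Sum>S\<in>{S. S \<subseteq> {1..2 * N + \<epsilon>} \<and> card S = 2 * k + \<epsilon>}.
                (\<integral>\<omega>. idx_prod \<alpha> S (\<mu> \<omega>) \<partial>M) *
                pairing_sum M \<zeta> \<alpha> ({1..2 * N + \<epsilon>} - S))) \<and>
         ((\<forall>S\<subseteq>{1..2 * N + \<epsilon>}. integrable M (\<lambda>\<omega>. idx_prod \<alpha> S (\<mu> \<omega>))) \<longrightarrow>
           integrable M (\<lambda>\<omega>. idx_prod \<alpha> {1..2 * N + \<epsilon>} (X \<omega>)))"
proof -
  interpret prob_space M by (rule assms(1))
  define A where "A = {1..2 * N + \<epsilon>}"
  have A: "finite A" "card A = 2 * N + \<epsilon>" by (simp_all add: A_def)
  define t where "t S = (\<lambda>\<omega>. idx_prod \<alpha> S (\<mu> \<omega>) * idx_prod \<alpha> (A - S) (\<zeta> \<omega>))" for S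
  define L where "L k = {S. S \<subseteq> A \<and> card S = 2 * k + \<epsilon>}" for k
  \<comment> \<open>\<open>E\<close> collects the subsets with the parity of \<open>\<epsilon>\<close>, that is, those with a complement of even
    size.\<close>
  define E where "E = (\<Union>k\<in>{0..N}. L k)"
  have ind: "indep_var borel (\<lambda>\<omega>. idx_prod \<alpha> S (\<mu> \<omega>)) borel (\<lambda>\<omega>. idx_prod \<alpha> J (\<zeta> \<omega>))" for S J
    using indep_var_compose[OF assms(5), of "idx_prod \<alpha> S" borel "idx_prod \<alpha> J" borel]
    by (simp add: o_def)
  have zint: "integrable M (\<lambda>\<omega>. idx_prod \<alpha> (A - S) (\<zeta> \<omega>))" for S
    using integrable_gaussian_monomial[OF assms(1,3,4)] A by simp
  have zval: "(\<integral>\<omega>. idx_prod \<alpha> (A - S) (\<zeta> \<omega>) \<partial>M) = pairing_sum M \<zeta> \<alpha> (A - S)" for S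
    using isserlis[OF assms(1,3,4)] A by simp
  have tint: "integrable M (t S)" if "integrable M (\<lambda>\<omega>. idx_prod \<alpha> S (\<mu> \<omega>))" for S
    unfolding t_def using indep_var_integrable[OF ind that zint] .
  have Eint: "integrable M (\<lambda>\<omega>. idx_prod \<alpha> S (\<mu> \<omega>))" if "S \<in> E" for S
    using that assms(9) unfolding E_def L_def A_def by auto
  have Xt: "idx_prod \<alpha> A (X \<omega>) = (\<Sum>S\<in>Pow A. t S \<omega>)" if "\<omega> \<in> space M" for \<omega>
    using assms(6)[OF that] A by (simp add: idx_prod_add t_def)
  have EA: "E \<subseteq> Pow A" "finite E" "\<And>k. finite (L k)"
    using A by (auto simp: E_def L_def intro: finite_subset[of _ "Pow A"])
  have odd_compl: "odd (card (A - S))" if "S \<in> Pow A - E" for S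
  proof
    assume "even (card (A - S))"
    then obtain j where "card (A - S) = 2 * j" by blast
    moreover have "card A = card S + card (A - S)"
    proof -
      have "S \<subseteq> A" using that by simp
      then show ?thesis
        using A(1) card_mono[OF A(1), of S] card_Diff_subset[OF finite_subset[OF _ A(1)], of S]
        by simp
    qed
    ultimately have "2 * N + \<epsilon> = card S + 2 * j" using A by simp
    then have "card S = 2 * (N - j) + \<epsilon>" "N - j \<le> N" using assms(8) by auto
    with that show False unfolding E_def L_def by fastforce
  qed
  have full: "integrable M (\<lambda>\<omega>. idx_prod \<alpha> A (X \<omega>))"
    if "\<forall>S\<subseteq>A. integrable M (\<lambda>\<omega>. idx_prod \<alpha> S (\<mu> \<omega>))"
  proof -
    have "integrable M (\<lambda>\<omega>. \<Sum>S\<in>Pow A. t S \<omega>)"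
      using that tint by (intro Bochner_Integration.integrable_sum) auto
    then show ?thesis using Xt by (simp cong: Bochner_Integration.integrable_cong)
  qed
  have formula: "(\<integral>\<omega>. idx_prod \<alpha> A (X \<omega>) \<partial>M)
      = (\<Sum>k=0..N. \<Sum>S\<in>L k. (\<integral>\<omega>. idx_prod \<alpha> S (\<mu> \<omega>) \<partial>M) * pairing_sum M \<zeta> \<alpha> (A - S))"
    if Xint: "integrable M (\<lambda>\<omega>. idx_prod \<alpha> A (X \<omega>))"
  proof -
    \<comment> \<open>\<open>r\<close> is the sum of the terms with an odd number of Gaussian factors. They cannot be treated one
      by one, because \<open>idx_prod \<alpha> S (\<mu> \<omega>)\<close> may fail to be integrable for these \<open>S\<close>; but their sum is
      integrable, as a difference of integrable functions.\<close>
    define r where "r p = (\<Sum>S\<in>Pow A - E. idx_prod \<alpha> S (fst p) * idx_prod \<alpha> (A - S) (snd p))"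
      for p :: "(real ^ 'd) \<times> (real ^ 'd)"
    have split: "idx_prod \<alpha> A (X \<omega>) = (\<Sum>S\<in>E. t S \<omega>) + r (\<mu> \<omega>, \<zeta> \<omega>)" if "\<omega> \<in> space M" for \<omega>
      using Xt[OF that] sum.subset_diff[OF EA(1), of "\<lambda>S. t S \<omega>"] A by (simp add: r_def t_def)
    have Esum: "integrable M (\<lambda>\<omega>. \<Sum>S\<in>E. t S \<omega>)"
      by (intro Bochner_Integration.integrable_sum tint Eint)
    have rint: "integrable M (\<lambda>\<omega>. r (\<mu> \<omega>, \<zeta> \<omega>))"
    proof -
      have "integrable M (\<lambda>\<omega>. idx_prod \<alpha> A (X \<omega>) - (\<Sum>S\<in>E. t S \<omega>))"
        using Xint Esum by (rule Bochner_Integration.integrable_diff)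
      then show ?thesis using split by (simp cong: Bochner_Integration.integrable_cong)
    qed
    have "(\<integral>\<omega>. r (\<mu> \<omega>, \<zeta> \<omega>) \<partial>M) = 0"
    proof (rule indep_integral_eq_0_of_sections[OF assms(5) _ rint])
      show "r \<in> borel_measurable (borel \<Otimes>\<^sub>M borel)"
        unfolding r_def by measurable
      \<comment> \<open>With \<open>\<mu>\<close> fixed at \<open>u\<close> the sum is a polynomial in \<open>\<zeta>\<close> with odd monomials only.\<close>
      fix u :: "real ^ 'd"
      have "(\<integral>\<omega>. r (u, \<zeta> \<omega>) \<partial>M)
          = (\<Sum>S\<in>Pow A - E. idx_prod \<alpha> S u * (\<integral>\<omega>. idx_prod \<alpha> (A - S) (\<zeta> \<omega>) \<partial>M))"
        using zint by (simp add: r_def)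
      also have "\<dots> = 0"
        using odd_compl A by (intro sum.neutral ballI) (simp add: zval pairing_sum_def pairings_odd)
      finally show "(\<integral>\<omega>. r (u, \<zeta> \<omega>) \<partial>M) = 0" .
    qed
    then have "(\<integral>\<omega>. idx_prod \<alpha> A (X \<omega>) \<partial>M) = (\<integral>\<omega>. (\<Sum>S\<in>E. t S \<omega>) \<partial>M)"
      using split Esum rint by (simp cong: Bochner_Integration.integral_cong)
    also have "\<dots> = (\<Sum>S\<in>E. \<integral>\<omega>. t S \<omega> \<partial>M)"
      by (intro Bochner_Integration.integral_sum tint Eint)
    also have "\<dots> = (\<Sum>S\<in>E. (\<integral>\<omega>. idx_prod \<alpha> S (\<mu> \<omega>) \<partial>M) * pairing_sum M \<zeta> \<alpha> (A - S))"
      unfolding t_def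
      using indep_var_lebesgue_integral[OF ind Eint zint] by (intro sum.cong refl) (simp add: zval)
    also have "\<dots> = (\<Sum>k=0..N. \<Sum>S\<in>L k. (\<integral>\<omega>. idx_prod \<alpha> S (\<mu> \<omega>) \<partial>M) * pairing_sum M \<zeta> \<alpha> (A - S))"
      unfolding E_def using EA(3) by (intro sum.UNION_disjoint) (auto simp: L_def)
    finally show ?thesis .
  qed
  show ?thesis
    using formula full unfolding A_def L_def by blast
qed

end
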